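(* Let $S_0\subset \mathbb{R}^d$ be a topological sphere with $\underline{\dim_B}\, S_0\in (d-1,d]$. For any $p>0$, there is no $p$-concentric sphere collection generated by $S_0$.
   Context: Throughout, $d\geq 2$ is a fixed integer. $B(0,1)$ and $S(0,1)$ denote the open unit ball and the unit Euclidean sphere in $\mathbb{R}^d$ centered at $0$. A set $S\subset\mathbb{R}^d$ is a topological sphere if $S=f(S(0,1))$ for some homeomorphism $f:\mathbb{R}^d\to\mathbb{R}^d$. A similarity is a map $g:\mathbb{R}^d\to\mathbb{R}^d$ of the form $g(x)=c_g\mathbf{A}x+t$ with $c_g>0$, $\mathbf{A}$ a real orthogonal $d\times d$ matrix, and $t\in\mathbb{R}^d$. For compact sets $A,B\subset \mathbb{R}^d$, $\operatorname{dist}(A,B)=\inf\{|a-b|: a\in A,\ b\in B\}$, and the Hausdorff distance is $d_H(A,B)=\max\{\sup_{a\in A}\operatorname{dist}(\{a\},B),\ \sup_{b\in B}\operatorname{dist}(A,\{b\})\}$. Definition (concentric sphere collection). Let $S_0\subset\mathbb{R}^d$ be a topological sphere with $S_0=f(S(0,1))$ for some homeomorphism $f:\mathbb{R}^d\to\mathbb{R}^d$. For a sequence of similarities $\{g_n\}_{n\in\mathbb{N}}$, set $S_n:=g_n(S_0)$. The union $S:=\bigcup_{n\in\mathbb{N}_0}S_n$ (where $\mathbb{N}_0=\mathbb{N}\cup\{0\}$) is a concentric sphere collection centered at $x_0$ and generated by $S_0$, for some $x_0\in f(B(0,1))$, if there are $c_1,c_2\in(0,1]$, $n_0\in\mathbb{N}$,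 and a strictly decreasing sequence $\{a_n\}_{n\in\mathbb{N}}$ converging to $0$ such that, for all $n\geq n_0$: (i) $d_H(S_n,\{x_0\})=c_1 a_n$, and (ii) $\operatorname{dist}(S_n,S_{n+1})=c_2(a_n-a_{n+1})$. If moreover there is $p>0$ so that $a_n=n^{-p}$ for all $n\geq n_0$, then $S$ is called a $p$-(polynomially) concentric sphere collection centered at $x_0$ and generated by $S_0$. For a non-empty bounded set $E\subset\mathbb{R}^d$ and $r>0$, $N_r(E)$ is the smallest number of $r$-cubes needed to cover $E$, i.e. cubes that lie in the axes-oriented $r$-mesh of $\mathbb{R}^d$ and intersect $E$. The lower box dimension of $E$ is $\underline{\dim_B}\,E=\liminf_{r\to0}\frac{\log N_r(E)}{-\log r}$.
   Formalization: The definition of a concentric sphere collection additionally requires that x_0 lie inside each S_n, i.e. x_0 ∈ g_n(f(B(0,1))), for all n ≥ n_0; without this the claim fails (e.g. copies of a Koch snowflake placed on alternating sides of x_0). *)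

theory Defs
  imports "HOL-Analysis.Analysis"
begin

text \<open>The ambient space is \<^typ>\<open>real^'n\<close>, with \<open>d = CARD('n)\<close>. The positive integers index the
  sequences, which are total functions on \<^typ>\<open>nat\<close> whose value at 0 is never used.\<close>

definition self_homeomorphism :: "(real^'n \<Rightarrow> real^'n) \<Rightarrow> bool" where
  "self_homeomorphism f \<longleftrightarrow> (\<exists>h. homeomorphism UNIV UNIV f h)"

definition topological_sphere :: "(real^'n) set \<Rightarrow> bool" where
  "topological_sphere S \<longleftrightarrow> (\<exists>f. self_homeomorphism f \<and> S = f ` sphere 0 1)"

definition similarity :: "(real^'n \<Rightarrow> real^'n) \<Rightarrow> bool" where
  "similarity g \<longleftrightarrow>
     (\<exists>c A t. c > 0 \<and> orthogonal_matrix A \<and> g = (\<lambda>x. c *\<^sub>R (A *v x) + t))"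

text \<open>Meaningful for non-empty compact sets, where the suprema are over bounded sets.\<close>

definition hausdorff_dist :: "(real^'n) set \<Rightarrow> (real^'n) set \<Rightarrow> real" where
  "hausdorff_dist A B = max (SUP a\<in>A. setdist {a} B) (SUP b\<in>B. setdist A {b})"

text \<open>The \<open>r\<close>-mesh consists of the closed cubes with side length \<open>r\<close> and vertices in
  \<open>r\<close> times the integer lattice. Of these, \<open>mesh_cubes r E\<close> collects those that meet \<open>E\<close>.\<close>

definition mesh_cubes :: "real \<Rightarrow> (real^'n) set \<Rightarrow> (real^'n) set set" where
  "mesh_cubes r E =
     {Q. (\<exists>k :: int^'n. Q = cbox (\<chi> i. r * of_int (k $ i)) (\<chi> i. r * (of_int (k $ i) + 1)))
         \<and> Q \<inter> E \<noteq> {}}"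

definition covering_number :: "real \<Rightarrow> (real^'n) set \<Rightarrow> nat" where
  "covering_number r E =
     (LEAST m. \<exists>\<C>. \<C> \<subseteq> mesh_cubes r E \<and> finite \<C> \<and> card \<C> = m \<and> E \<subseteq> \<Union>\<C>)"

definition lower_box_dim :: "(real^'n) set \<Rightarrow> ereal" where
  "lower_box_dim E =
     Liminf (at_right 0) (\<lambda>r. ereal (ln (real (covering_number r E)) / - ln r))"

text \<open>The predicate below lists what the existential quantifiers in the definition of a
  concentric sphere collection range over. Its last conjunct says that the centre \<open>x0\<close> is
  surrounded by each of the spheres \<open>g n ` S0\<close> with \<open>n \<ge> n0\<close>, just as \<open>x0 \<in> f ` ball 0 1\<close>
  says so for \<open>S0\<close>. This is part of what ``concentric, centered at \<open>x0\<close>'' means, and does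
  not follow from the two distance conditions: the spheres with odd and even \<open>n\<close> could
  otherwise lie on opposite sides of \<open>x0\<close>, the spheres of equal parity intersecting each
  other.\<close>

definition concentric_witness ::
  "(real^'n \<Rightarrow> real^'n) \<Rightarrow> (nat \<Rightarrow> real^'n \<Rightarrow> real^'n) \<Rightarrow> real \<Rightarrow> real \<Rightarrow> nat \<Rightarrow> (nat \<Rightarrow> real)
     \<Rightarrow> real^'n \<Rightarrow> (real^'n) set \<Rightarrow> bool" where
  "concentric_witness f g c1 c2 n0 a x0 S0 \<longleftrightarrow>
     self_homeomorphism f \<and> S0 = f ` sphere 0 1 \<and> x0 \<in> f ` ball 0 1 \<and>
     (\<forall>n\<ge>1. similarity (g n)) \<and>
     c1 \<in> {0<..1} \<and> c2 \<in> {0<..1} \<and> n0 \<ge> 1 \<and>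
     (\<forall>m\<ge>1. \<forall>n>m. a n < a m) \<and> a \<longlonglongrightarrow> 0 \<and>
     (\<forall>n\<ge>n0. hausdorff_dist (g n ` S0) {x0} = c1 * a n
           \<and> setdist (g n ` S0) (g (n + 1) ` S0) = c2 * (a n - a (n + 1))
           \<and> x0 \<in> g n ` f ` ball 0 1)"

definition concentric_sphere_collection ::
  "(real^'n) set \<Rightarrow> real^'n \<Rightarrow> (real^'n) set \<Rightarrow> bool" where
  "concentric_sphere_collection S x0 S0 \<longleftrightarrow>
     (\<exists>f g c1 c2 n0 a. concentric_witness f g c1 c2 n0 a x0 S0 \<and>
        S = S0 \<union> (\<Union>n\<in>{1..}. g n ` S0))"

definition p_concentric_sphere_collection ::
  "real \<Rightarrow> (real^'n) set \<Rightarrow> real^'n \<Rightarrow> (real^'n) set \<Rightarrow> bool" where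
  "p_concentric_sphere_collection p S x0 S0 \<longleftrightarrow>
     p > 0 \<and>
     (\<exists>f g c1 c2 n0 a. concentric_witness f g c1 c2 n0 a x0 S0 \<and>
        (\<forall>n\<ge>n0. a n = real n powr (- p)) \<and>
        S = S0 \<union> (\<Union>n\<in>{1..}. g n ` S0))"

end

theory Submission
  imports Defs "HOL-Real_Asymp.Real_Asymp"
begin

text \<open>The spheres \<open>S\<^sub>n\<close> are nested, and for \<open>N \<le> n < 2N\<close> consecutive ones are at distance at least a
  constant times \<open>N\<^sup>-\<^sup>p\<^sup>-\<^sup>1\<close>, which is of order \<open>1/N\<close> relative to their size \<open>N\<^sup>-\<^sup>p\<close>. If
  \<open>d - 1 < s < dim S\<^sub>0\<close>, then \<open>S\<^sub>0\<close> contains of the order of at least \<open>N\<^sup>s\<close> points that are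
  \<open>\<kappa>/N\<close>-separated. Their images under all \<open>g\<^sub>n\<close> with \<open>N \<le> n < 2N\<close> form a separated set in a ball
  whose radius is of order \<open>N\<close> times the separation, so comparing volumes gives
  \<open>N * N\<^sup>s \<le> C N\<^sup>d\<close> for all large \<open>N\<close>, which is impossible as \<open>s > d - 1\<close>.\<close>

section \<open>Similarities, and regions bounded by images of spheres\<close>

lemma similarity_dist:
  fixes g :: "real^'n \<Rightarrow> real^'n"
  assumes "similarity g"
  obtains c where "c > 0" "\<And>x y. dist (g x) (g y) = c * dist x y"
proof -
  obtain c A t where c: "c > 0" and A: "orthogonal_matrix A"
    and g: "g = (\<lambda>x. c *\<^sub>R (A *v x) + t)"
    using assms unfolding similarity_def by blast
  have ot: "orthogonal_transformation ((*v) A)"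
    using A by (simp add: orthogonal_transformation_matrix)
  have "dist (g x) (g y) = c * dist x y" for x y
  proof -
    have "g x - g y = c *\<^sub>R (A *v (x - y))"
      by (simp add: g algebra_simps)
    then show ?thesis
      using c orthogonal_transformation_norm[OF ot] by (simp add: dist_norm)
  qed
  with c show thesis by (rule that)
qed

text \<open>Openness is invariance of domain. The image of the closed ball is compact and so
  contains the closure of the image of the open ball, which leaves only the image of the sphere for
  the frontier.\<close>

lemma frontier_injective_image_ball:
  fixes F :: "'a::euclidean_space \<Rightarrow> 'a"
  assumes "continuous_on UNIV F" "inj F"
  shows "open (F ` ball a r)" "frontier (F ` ball a r) \<subseteq> F ` sphere a r"
proof -
  show op: "open (F ` ball a r)"
    using assms by (meson continuous_on_subset inj_on_subset invariance_of_domain open_ball subset_UNIV)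
  have "closed (F ` cball a r)"
    using assms by (meson compact_cball compact_continuous_image compact_imp_closed continuous_on_subset subset_UNIV)
  then have "closure (F ` ball a r) \<subseteq> F ` cball a r"
    by (meson ball_subset_cball closure_minimal image_mono)
  moreover have "F ` cball a r - F ` ball a r \<subseteq> F ` sphere a r"
    by (force simp: less_eq_real_def)
  ultimately show "frontier (F ` ball a r) \<subseteq> F ` sphere a r"
    using op by (auto simp: frontier_def interior_open)
qed

text \<open>From a point of \<open>D\<close> outside the ball, the ray pointing away from
  \<open>a\<close> must leave the bounded set \<open>D\<close>, and it does so at a frontier point
  even farther from \<open>a\<close>.\<close>

lemma subset_cball_if_frontier_subset_cball:
  fixes D :: "'a::euclidean_space set"
  assumes "bounded D" "open D" "frontier D \<subseteq> cball a R" "R \<ge> 0"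
  shows "D \<subseteq> cball a R"
proof
  fix y assume y: "y \<in> D"
  show "y \<in> cball a R"
  proof (rule ccontr)
    assume far: "y \<notin> cball a R"
    then have ne: "y - a \<noteq> 0" using assms(4) by auto
    obtain d where d: "0 < d" "y + d *\<^sub>R (y - a) \<in> frontier D"
      using ray_to_frontier[OF assms(1) _ ne] y assms(2) by (metis interior_open)
    have "y + d *\<^sub>R (y - a) - a = (1 + d) *\<^sub>R (y - a)" by (simp add: algebra_simps)
    then have "dist a (y + d *\<^sub>R (y - a)) = (1 + d) * dist a y"
      using d by (metis abs_of_pos add_pos_pos dist_commute dist_norm norm_scaleR zero_less_one)
    also have "\<dots> \<ge> dist a y" using d by (simp add: mult_le_cancel_right1)
    finally show False using far d assms(3) by auto
  qed
qed

section \<open>Volume comparison: mesh cubes and separated sets\<close>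

lemma lmeasurable_nbhd:
  fixes E :: "'a::euclidean_space set"
  assumes "bounded E"
  shows "(\<Union>x\<in>E. ball x \<delta>) \<in> lmeasurable"
proof -
  obtain a R where "E \<subseteq> cball a R" using assms by (auto simp: bounded_def subset_iff)
  then have "(\<Union>x\<in>E. ball x \<delta>) \<subseteq> cball a (R + \<delta>)"
    by (force simp: subset_iff intro: order_trans[OF dist_triangle] add_mono)
  then have "bounded (\<Union>x\<in>E. ball x \<delta>)" using bounded_cball bounded_subset by blast
  then show ?thesis by (intro lmeasurable_open) auto
qed

text \<open>A volume count: the mesh cubes meeting \<open>E\<close> overlap only in null sets, and
  they lie in the \<delta>-neighbourhood because their diameter is less than \<delta>.\<close>

lemma covering_number_le_measure_nbhd:
  fixes E :: "(real^'n) set" and r :: real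
  assumes E: "bounded E" and r: "r > 0" and \<delta>: "r * real CARD('n) < \<delta>"
  shows "real (covering_number r E) * r ^ CARD('n) \<le> measure lebesgue (\<Union>x\<in>E. ball x \<delta>)"
proof -
  define Q :: "int^'n \<Rightarrow> (real^'n) set"
    where "Q k = cbox (\<chi> i. r * of_int (k $ i)) (\<chi> i. r * (of_int (k $ i) + 1))" for k
  define U where "U = (\<Union>x\<in>E. ball x \<delta>)"
  have mesh: "mesh_cubes r E = {C. (\<exists>k. C = Q k) \<and> C \<inter> E \<noteq> {}}"
    by (simp add: mesh_cubes_def Q_def)
  have U: "U \<in> lmeasurable"
    unfolding U_def by (rule lmeasurable_nbhd[OF E])
  have measQ: "measure lebesgue (Q k) = r ^ CARD('n)" for k
  proof -
    have "cbox (\<chi> i. r * of_int (k $ i)) (\<chi> i. r * (of_int (k $ i) + 1)) \<noteq> ({} :: (real^'n) set)"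
      using r by (auto simp: interval_ne_empty_cart)
    then show ?thesis
      unfolding Q_def by (simp add: content_cbox_cart algebra_simps)
  qed
  \<comment> \<open>Cubes whose indices differ in coordinate \<open>i\<close> share at most a piece
    of a hyperplane orthogonal to that axis.\<close>
  have neg: "negligible (Q k \<inter> Q l)" if less: "k $ i < l $ i" for k l i
  proof -
    have "Q k \<inter> Q l \<subseteq> {x. axis i 1 \<bullet> x = r * of_int (l $ i)}"
    proof clarify
      fix x assume x: "x \<in> Q k" "x \<in> Q l"
      have 1: "x $ i \<le> r * (of_int (k $ i) + 1)" and 2: "r * of_int (l $ i) \<le> x $ i"
        using x by (auto simp: Q_def mem_box_cart)
      have "real_of_int (k $ i) + 1 \<le> of_int (l $ i)" using less by linarith
      then have "r * (of_int (k $ i) + 1) \<le> r * of_int (l $ i)"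
        using r by (intro mult_left_mono) auto
      then show "axis i 1 \<bullet> x = r * of_int (l $ i)" 
        using 1 2 by (simp add: inner_axis')
    qed
    moreover have "negligible {x. axis i (1::real) \<bullet> x = r * of_int (l $ i)}"
      by (rule negligible_hyperplane) simp
    ultimately show ?thesis using negligible_subset by blast
  qed
  have sub: "C \<subseteq> U" if C: "C \<in> mesh_cubes r E" for C
  proof
    fix y assume y: "y \<in> C"
    obtain k x where k: "C = Q k" and x: "x \<in> C" "x \<in> E" using C unfolding mesh by blast
    have "\<bar>(x - y) $ i\<bar> \<le> r" for i
    proof -
      have "r * of_int (k $ i) \<le> x $ i" "x $ i \<le> r * of_int (k $ i) + r"
        "r * of_int (k $ i) \<le> y $ i" "y $ i \<le> r * of_int (k $ i) + r"
        using x(1) y unfolding k Q_def by (auto simp: mem_box_cart algebra_simps)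
      then show ?thesis by simp
    qed
    \<comment> \<open>The l1 norm dominates the Euclidean one. The resulting diameter bound is
      crude, but costs only a constant depending on the dimension.\<close>
    then have "(\<Sum>i\<in>UNIV. \<bar>(x - y) $ i\<bar>) \<le> (\<Sum>i\<in>(UNIV::'n set). r)"
      by (intro sum_mono) auto
    then have "dist x y \<le> r * real CARD('n)"
      using norm_le_l1_cart[of "x - y"] by (simp add: dist_norm mult.commute)
    then show "y \<in> U" using x(2) \<delta> unfolding U_def by force
  qed
  \<comment> \<open>Finite subfamilies come first, since the finiteness of
    \<open>mesh_cubes r E\<close> is itself deduced from this bound: large finite subfamilies would
    exceed the available volume.\<close>
  have bound: "real (card G) * r ^ CARD('n) \<le> measure lebesgue U" if G: "G \<subseteq> mesh_cubes r E" "finite G" for G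
  proof -
    have lm: "C \<in> lmeasurable \<and> measure lebesgue C = r ^ CARD('n)" if "C \<in> G" for C
    proof -
      obtain k where "C = Q k" using \<open>C \<in> G\<close> G unfolding mesh by blast
      then show ?thesis using measQ by (simp add: Q_def)
    qed
    have "pairwise (\<lambda>S T. negligible (S \<inter> T)) G"
    proof (rule pairwiseI)
      fix S T assume ST: "S \<in> G" "T \<in> G" "S \<noteq> T"
      obtain k l where kl: "S = Q k" "T = Q l" using ST G unfolding mesh by blast
      then have "k \<noteq> l" using ST by auto
      then obtain i where "k $ i \<noteq> l $ i" by (auto simp: vec_eq_iff)
      then show "negligible (S \<inter> T)"
        using neg[of k i l] neg[of l i k] unfolding kl by (metis Int_commute linorder_neqE)
    qed
    then have "measure lebesgue (\<Union>G) = (\<Sum>S\<in>G. measure lebesgue S)"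
      using lm G by (intro measure_negligible_finite_Union) auto
    also have "\<dots> = real (card G) * r ^ CARD('n)" using lm by simp
    finally have "real (card G) * r ^ CARD('n) = measure lebesgue (\<Union>G)" ..
    also have "\<dots> \<le> measure lebesgue U"
      using lm G sub U by (intro measure_mono_fmeasurable) (auto intro!: sets.finite_Union)
    finally show ?thesis .
  qed
  have fin: "finite (mesh_cubes r E)"
  proof (rule ccontr)
    assume inf: "infinite (mesh_cubes r E)"
    obtain m :: nat where m: "measure lebesgue U / r ^ CARD('n) < m" using reals_Archimedean2 by blast
    obtain G where "G \<subseteq> mesh_cubes r E" "finite G" "card G = m"
      using inf infinite_arbitrarily_large by blast
    then show False using bound[of G] m r by (simp add: field_simps)
  qed
  have cover: "E \<subseteq> \<Union>(mesh_cubes r E)"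
  proof
    fix x assume x: "x \<in> E"
    define k :: "int^'n" where "k = (\<chi> i. \<lfloor>x $ i / r\<rfloor>)"
    have "x \<in> Q k"
    proof -
      have "r * of_int \<lfloor>x $ i / r\<rfloor> \<le> x $ i" for i
        using r mult_left_mono[OF of_int_floor_le[of "x $ i / r"], of r] by simp
      moreover have "x $ i \<le> r * (of_int \<lfloor>x $ i / r\<rfloor> + 1)" for i
        using r mult_left_mono[OF real_of_int_floor_add_one_ge[of "x $ i / r"], of r] by simp
      ultimately show ?thesis by (simp add: Q_def mem_box_cart k_def)
    qed
    then show "x \<in> \<Union>(mesh_cubes r E)" using x unfolding mesh by blast
  qed
  \<comment> \<open>The family of all mesh cubes meeting \<open>E\<close> is one of the competitors
    for the \<open>LEAST\<close>.\<close>
  have "covering_number r E \<le> card (mesh_cubes r E)"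
    unfolding covering_number_def by (rule Least_le) (use fin cover in auto)
  then have "real (covering_number r E) * r ^ CARD('n) \<le> card (mesh_cubes r E) * r ^ CARD('n)"
    using r by (intro mult_right_mono) auto
  also have "\<dots> \<le> measure lebesgue U" using bound fin by blast
  finally show ?thesis unfolding U_def .
qed

text \<open>Packing bound: the balls of radius \<rho> around the points are disjoint and lie in one
  ball of radius R + \<rho>, and the volume of the unit ball cancels. An indexed family lets points
  on several spheres be indexed by pairs.\<close>

lemma separated_family_card_le:
  fixes x :: "'i \<Rightarrow> 'a::euclidean_space" and \<rho> R :: real
  assumes I: "finite I" and sep: "\<And>i j. \<lbrakk>i \<in> I; j \<in> I; i \<noteq> j\<rbrakk> \<Longrightarrow> 2 * \<rho> \<le> dist (x i) (x j)"
    and "\<rho> > 0" "R \<ge> 0" and bd: "\<And>i. i \<in> I \<Longrightarrow> dist a (x i) \<le> R"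
  shows "real (card I) * \<rho> ^ DIM('a) \<le> (R + \<rho>) ^ DIM('a)"
proof -
  define \<omega> where "\<omega> = measure lborel (ball (0::'a) 1)"
  have \<omega>: "\<omega> > 0" unfolding \<omega>_def by (rule content_ball_pos) simp
  have ball: "measure lebesgue (ball (c::'a) r) = r ^ DIM('a) * \<omega>" if "r \<ge> 0" for c r
    using content_ball_conv_unit_ball[OF that, of c] unfolding \<omega>_def by simp
  have disj: "ball (x i) \<rho> \<inter> ball (x j) \<rho> = {}" if "i \<in> I" "j \<in> I" "i \<noteq> j" for i j
  proof (rule ccontr)
    assume "ball (x i) \<rho> \<inter> ball (x j) \<rho> \<noteq> {}"
    then obtain z where "dist (x i) z < \<rho>" "dist (x j) z < \<rho>" by auto
    then show False using sep[OF that] dist_triangle2[of "x i" "x j" z] by simp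
  qed
  have "real (card I) * (\<rho> ^ DIM('a) * \<omega>) = (\<Sum>i\<in>I. measure lebesgue (ball (x i) \<rho>))"
    using ball \<open>\<rho> > 0\<close> by simp
  also have "\<dots> = measure lebesgue (\<Union>i\<in>I. ball (x i) \<rho>)"
    using I disj by (intro measure_negligible_finite_Union_image[symmetric]) (auto simp: pairwise_def)
  also have "\<dots> \<le> measure lebesgue (ball a (R + \<rho>))"
  proof (rule measure_mono_fmeasurable)
    show "(\<Union>i\<in>I. ball (x i) \<rho>) \<subseteq> ball a (R + \<rho>)"
    proof clarify
      fix i y assume i: "i \<in> I" and y: "y \<in> ball (x i) \<rho>"
      have "dist a y \<le> dist a (x i) + dist (x i) y" by (rule dist_triangle)
      then show "y \<in> ball a (R + \<rho>)" using bd[OF i] y by simp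
    qed
  qed (use I in auto)
  also have "\<dots> = (R + \<rho>) ^ DIM('a) * \<omega>" using ball assms by simp
  finally show ?thesis using \<omega> by (simp add: mult.assoc[symmetric])
qed

text \<open>The packing bound limits the size of separated subsets, so one of greatest cardinality
  exists; a point left uncovered could be added to it.\<close>

lemma maximal_separated_subset:
  fixes E :: "'a::euclidean_space set"
  assumes E: "bounded E" and \<delta>: "\<delta> > 0"
  obtains P where "finite P" "P \<subseteq> E" "\<And>x y. \<lbrakk>x \<in> P; y \<in> P; x \<noteq> y\<rbrakk> \<Longrightarrow> \<delta> \<le> dist x y"
    "E \<subseteq> (\<Union>x\<in>P. ball x \<delta>)"
proof -
  define sep where "sep P \<longleftrightarrow> finite P \<and> P \<subseteq> E \<and> (\<forall>x\<in>P. \<forall>y\<in>P. x \<noteq> y \<longrightarrow> \<delta> \<le> dist x y)" for P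
  obtain a R0 where R0: "\<forall>x\<in>E. dist a x \<le> R0" using E unfolding bounded_def by blast
  define R where "R = max 0 R0"
  obtain b :: nat where b: "(R + \<delta>/2) ^ DIM('a) / (\<delta>/2) ^ DIM('a) < b" using reals_Archimedean2 by blast
  have "card P < b" if "sep P" for P
  proof -
    have "real (card P) * (\<delta>/2) ^ DIM('a) \<le> (R + \<delta>/2) ^ DIM('a)"
      by (rule separated_family_card_le[where x = id and a = a])
        (use that R0 \<delta> in \<open>auto simp: sep_def R_def intro: max.coboundedI2\<close>)
    also have "\<dots> < b * (\<delta>/2) ^ DIM('a)" using b \<delta> by (simp add: pos_divide_less_eq)
    finally have "real (card P) < b" by (rule mult_right_less_imp_less) (use \<delta> in simp)
    then show ?thesis by simp
  qed
  moreover have "sep {}" by (simp add: sep_def)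
  ultimately obtain P where P: "sep P" and max: "\<And>P'. sep P' \<Longrightarrow> card P' \<le> card P"
    using ex_has_greatest_nat[of sep "{}" card b] by (metis less_imp_le)
  show thesis
  proof
    show "finite P" "P \<subseteq> E" "\<And>x y. \<lbrakk>x \<in> P; y \<in> P; x \<noteq> y\<rbrakk> \<Longrightarrow> \<delta> \<le> dist x y"
      using P by (auto simp: sep_def)
    show "E \<subseteq> (\<Union>x\<in>P. ball x \<delta>)"
    proof (rule ccontr)
      assume "\<not> E \<subseteq> (\<Union>x\<in>P. ball x \<delta>)"
      then obtain z where z: "z \<in> E" "\<forall>x\<in>P. \<delta> \<le> dist x z"
        by (auto simp: subset_iff not_less)
      then have "sep (insert z P)" using P by (auto simp: sep_def dist_commute)
      moreover have "z \<notin> P" using z \<delta> by auto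
      ultimately show False using max[of "insert z P"] P by (simp add: sep_def)
    qed
  qed
qed

text \<open>Links box counting to packing: balls of radius 2\<delta> around a maximal
  \<delta>-separated set cover the whole \<delta>-neighbourhood of \<open>E\<close>, whose volume
  bounds the covering number.\<close>

lemma covering_number_le_separated_card:
  fixes E :: "(real^'n) set" and r :: real
  assumes E: "bounded E" and r: "r > 0"
  obtains P where "finite P" "P \<subseteq> E"
    "\<And>x y. \<lbrakk>x \<in> P; y \<in> P; x \<noteq> y\<rbrakk> \<Longrightarrow> 2 * real CARD('n) * r \<le> dist x y"
    "real (covering_number r E) \<le> real (card P) * ((4 * real CARD('n)) ^ CARD('n) * measure lborel (ball (0::real^'n) 1))"
proof -
  let ?d = "CARD('n)"
  let ?\<omega> = "measure lborel (ball (0::real^'n) 1)"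
  \<comment> \<open>The factor 2 gives the strict inequality that the volume count requires. As
    \<delta> is proportional to \<open>r\<close>, the power of \<open>r\<close> cancels at the end,
    and 2\<delta> = 4dr explains the constant.\<close>
  define \<delta> where "\<delta> = 2 * real ?d * r"
  have \<delta>: "\<delta> > 0" "r * real ?d < \<delta>" using r by (auto simp: \<delta>_def)
  obtain P where P: "finite P" "P \<subseteq> E" "\<And>x y. \<lbrakk>x \<in> P; y \<in> P; x \<noteq> y\<rbrakk> \<Longrightarrow> \<delta> \<le> dist x y"
    "E \<subseteq> (\<Union>x\<in>P. ball x \<delta>)"
    using maximal_separated_subset[OF E \<delta>(1)] by metis
  have sub: "(\<Union>x\<in>E. ball x \<delta>) \<subseteq> (\<Union>x\<in>P. ball x (2 * \<delta>))"
  proof clarify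
    fix x y assume x: "x \<in> E" and y: "y \<in> ball x \<delta>"
    obtain z where z: "z \<in> P" "dist z x < \<delta>" using P(4) x by auto
    then have "dist z y < 2 * \<delta>" using dist_triangle[of z y x] y by simp
    with z show "y \<in> (\<Union>x\<in>P. ball x (2 * \<delta>))" by auto
  qed
  have "real (covering_number r E) * r ^ ?d \<le> measure lebesgue (\<Union>x\<in>E. ball x \<delta>)"
    by (rule covering_number_le_measure_nbhd[OF E r \<delta>(2)])
  also have "\<dots> \<le> measure lebesgue (\<Union>x\<in>P. ball x (2 * \<delta>))"
    by (rule measure_mono_fmeasurable[OF sub])
      (use lmeasurable_nbhd[OF E] lmeasurable_nbhd[OF finite_imp_bounded[OF P(1)]] in \<open>auto simp: fmeasurableD\<close>)
  also have "\<dots> \<le> (\<Sum>x\<in>P. measure lebesgue (ball x (2 * \<delta>)))"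
    using P(1) by (intro measure_UNION_le) auto
  also have "\<dots> = real (card P) * ((2 * \<delta>) ^ ?d * ?\<omega>)"
    using \<delta> content_ball_conv_unit_ball[of "2 * \<delta>" "_::real^'n"] by simp
  also have "\<dots> = real (card P) * ((4 * real ?d) ^ ?d * ?\<omega>) * r ^ ?d"
    by (simp add: \<delta>_def power_mult_distrib mult_ac)
  finally have "real (covering_number r E) \<le> real (card P) * ((4 * real ?d) ^ ?d * ?\<omega>)"
    using r by (simp add: mult_le_cancel_right)
  with P(1-3) show thesis by (intro that) (auto simp: \<delta>_def)
qed

section \<open>Nesting of disjoint spheres around a common point\<close>

text \<open>The first supremum in \<open>hausdorff_dist\<close> is the largest distance from
  \<open>z\<close> to \<open>S\<close>, attained by compactness; the second runs over
  \<open>z\<close> alone and is the smallest distance, so the maximum is the first.\<close>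

lemma hausdorff_dist_singleton:
  fixes S :: "(real^'n) set"
  assumes "compact S" "S \<noteq> {}"
  shows "s \<in> S \<Longrightarrow> dist z s \<le> hausdorff_dist S {z}" "\<exists>s\<in>S. dist z s = hausdorff_dist S {z}"
proof -
  obtain s where s: "s \<in> S" "\<And>y. y \<in> S \<Longrightarrow> dist z y \<le> dist z s"
    using distance_attains_sup[OF assms] by blast
  have "(SUP a\<in>S. setdist {a} {z}) = dist z s"
  proof (rule cSup_eq_maximum)
    show "dist z s \<in> (\<lambda>a. setdist {a} {z}) ` S" using s by (force simp: dist_commute)
  qed (use s in \<open>auto simp: dist_commute\<close>)
  moreover have "setdist S {z} \<le> dist z s"
    using setdist_le_dist[OF s(1), of z "{z}"] by (simp add: dist_commute)
  ultimately have eq: "hausdorff_dist S {z} = dist z s"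
    unfolding hausdorff_dist_def by simp
  show "s \<in> S \<Longrightarrow> dist z s \<le> hausdorff_dist S {z}" for s
    using s(2) unfolding eq .
  show "\<exists>s\<in>S. dist z s = hausdorff_dist S {z}" using s(1) eq by auto
qed

text \<open>The point \<open>s\<close> decides which sphere is the outer one. It is outside the
  region of \<open>G\<close>, so the connected sphere of \<open>F\<close> (here dimension at least 2
  enters) cannot enter that region without crossing the sphere of \<open>G\<close>. Then the closed
  region of \<open>G\<close> is connected, misses the sphere of \<open>F\<close> and contains
  \<open>z\<close>, so it stays inside.\<close>

lemma injective_image_cball_nested:
  fixes F G :: "'a::euclidean_space \<Rightarrow> 'a"
  assumes dim: "DIM('a) \<ge> 2"
    and F: "continuous_on UNIV F" "inj F" and G: "continuous_on UNIV G" "inj G"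
    and disj: "F ` sphere 0 1 \<inter> G ` sphere 0 1 = {}"
    and z: "z \<in> F ` ball 0 1" "z \<in> G ` ball 0 1"
    and R: "G ` sphere 0 1 \<subseteq> cball z R" "R \<ge> 0"
    and s: "s \<in> F ` sphere 0 1" "dist z s > R"
  shows "G ` cball 0 1 \<subseteq> F ` ball 0 1"
proof -
  have cball: "H ` cball 0 1 = H ` ball 0 1 \<union> H ` sphere 0 1" for H :: "'a \<Rightarrow> 'a"
    unfolding image_Un[symmetric] by (rule arg_cong[where f = "(`) H"]) auto
  note frF = frontier_injective_image_ball[OF F, of 0 1]
  note frG = frontier_injective_image_ball[OF G, of 0 1]
  have "compact (G ` cball 0 1)"
    using G(1) by (meson compact_cball compact_continuous_image continuous_on_subset subset_UNIV)
  then have "bounded (G ` ball 0 1)"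
    by (meson ball_subset_cball bounded_subset compact_imp_bounded image_mono)
  then have "G ` ball 0 1 \<subseteq> cball z R"
    by (rule subset_cball_if_frontier_subset_cball[OF _ frG(1) order_trans[OF frG(2) R(1)] R(2)])
  then have "s \<notin> G ` ball 0 1" using s(2) by auto
  moreover have "connected (F ` sphere 0 1)"
    using F(1) connected_sphere[OF dim] by (meson connected_continuous_image continuous_on_subset subset_UNIV)
  ultimately have "F ` sphere 0 1 \<inter> G ` ball 0 1 = {}"
    using connected_Int_frontier[of "F ` sphere 0 1" "G ` ball 0 1"] s(1) frG disj by blast
  with disj have "F ` sphere 0 1 \<inter> G ` cball 0 1 = {}"
    unfolding cball by blast
  moreover have "connected (G ` cball 0 1)"
    using G(1) by (meson connected_continuous_image continuous_on_subset subset_UNIV convex_cball convex_connected)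
  moreover have "z \<in> G ` cball 0 1" using z(2) unfolding cball by blast
  ultimately show ?thesis
    using connected_Int_frontier[of "G ` cball 0 1" "F ` ball 0 1"] z(1) frF by blast
qed

text \<open>The segment from a point outside the region to a point inside it crosses the bounding
  sphere.\<close>

lemma setdist_le_dist_across:
  fixes G :: "'a::euclidean_space \<Rightarrow> 'a"
  assumes G: "continuous_on UNIV G" "inj G"
    and x: "x \<in> A" "x \<notin> G ` ball 0 1" and y: "y \<in> G ` cball 0 1"
  shows "setdist A (G ` sphere 0 1) \<le> dist x y"
proof (cases "y \<in> G ` ball 0 1")
  case True
  have "closed_segment x y \<inter> frontier (G ` ball 0 1) \<noteq> {}"
    using x True by (intro connected_Int_frontier) auto
  then obtain z where z: "z \<in> closed_segment x y" "z \<in> G ` sphere 0 1"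
    using frontier_injective_image_ball[OF G, of 0 1] by blast
  have "setdist A (G ` sphere 0 1) \<le> dist x z" by (rule setdist_le_dist[OF x(1) z(2)])
  also have "\<dots> \<le> dist x y" using dist_in_closed_segment[OF z(1)] by (simp add: dist_commute)
  finally show ?thesis .
next
  case False
  then have "y \<in> G ` sphere 0 1" using y by (force simp: less_eq_real_def)
  then show ?thesis by (rule setdist_le_dist[OF x(1)])
qed

section \<open>Separation and counting in a concentric collection\<close>

text \<open>Mean value theorem: on the interval, the derivative of \<open>z powr (-p)\<close> is
  smallest in absolute value at the right end point.\<close>

lemma powr_minus_diff_ge:
  fixes x y p :: real
  assumes "0 < x" "x < y" "p > 0"
  shows "x powr (-p) - y powr (-p) \<ge> p * (y - x) * y powr (- p - 1)"
proof -
  have "\<exists>z>x. z < y \<and> y powr (-p) - x powr (-p) = (y - x) * (- p * z powr (- p - 1))"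
    by (rule MVT2[OF assms(2)]) (use assms in \<open>auto intro!: derivative_eq_intros\<close>)
  then obtain z where z: "x < z" "z < y" "y powr (-p) - x powr (-p) = (y - x) * (- p * z powr (- p - 1))"
    by blast
  have "y powr (- p - 1) \<le> z powr (- p - 1)" using z assms by (intro powr_mono2') auto
  then have "p * (y - x) * y powr (- p - 1) \<le> p * (y - x) * z powr (- p - 1)"
    using assms by (intro mult_left_mono) auto
  then show ?thesis using z(3) by (simp add: algebra_simps)
qed

text \<open>Collects what the counting uses. Nesting turns the gap between consecutive spheres into
  a gap between any two; the third claim bounds the ratio of \<open>g n\<close> below by a fixed
  multiple of \<open>a n\<close>.\<close>

lemma concentric_separated_dist:
  fixes f :: "real^'n \<Rightarrow> real^'n"
  assumes d: "CARD('n) \<ge> 2" and w: "concentric_witness f g c1 c2 n0 a x0 S0"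
    and pos: "\<And>n. n \<ge> n0 \<Longrightarrow> a n > 0"
  shows "\<lbrakk>n \<ge> n0; m > n; x \<in> g n ` S0; y \<in> g m ` S0\<rbrakk> \<Longrightarrow> c2 * (a n - a (n + 1)) \<le> dist x y"
    and "\<lbrakk>n \<ge> n0; x \<in> g n ` S0\<rbrakk> \<Longrightarrow> dist x0 x \<le> c1 * a n"
    and "\<exists>M>0. \<forall>n\<ge>n0. \<exists>c. (\<forall>x y. dist (g n x) (g n y) = c * dist x y) \<and> c1 * a n \<le> c * M"
proof -
  have S0: "S0 = f ` sphere 0 1" and sim: "\<And>n. n \<ge> 1 \<Longrightarrow> similarity (g n)"
    and c1: "c1 > 0" and c2: "c2 > 0" and n0: "n0 \<ge> 1"
    and dec: "\<And>m n. \<lbrakk>m \<ge> 1; n > m\<rbrakk> \<Longrightarrow> a n < a m"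
    and H: "\<And>n. n \<ge> n0 \<Longrightarrow> hausdorff_dist (g n ` S0) {x0} = c1 * a n"
    and gap: "\<And>n. n \<ge> n0 \<Longrightarrow> setdist (g n ` S0) (g (n + 1) ` S0) = c2 * (a n - a (n + 1))"
    and x0: "\<And>n. n \<ge> n0 \<Longrightarrow> x0 \<in> g n ` f ` ball 0 1"
    using w unfolding concentric_witness_def by auto
  obtain h where "homeomorphism UNIV UNIV f h"
    using w unfolding concentric_witness_def self_homeomorphism_def by blast
  then have f: "continuous_on UNIV f" "inj f"
    unfolding homeomorphism_def by (auto intro: inj_on_inverseI)
  define F where "F n = g n \<circ> f" for n
  have gcont: "continuous_on UNIV (g n) \<and> inj (g n)" if n: "n \<ge> 1" for n
  proof -
    obtain c where c: "c > 0" "\<And>x y. dist (g n x) (g n y) = c * dist x y"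
      using similarity_dist[OF sim[OF n]] by metis
    then have "c-lipschitz_on UNIV (g n)" by (intro lipschitz_onI) auto
    moreover have "inj (g n)"
    proof (rule injI)
      fix x y assume "g n x = g n y"
      then show "x = y" using c(1) c(2)[of x y] by simp
    qed
    ultimately show ?thesis using lipschitz_on_continuous_on by blast
  qed
  have F: "continuous_on UNIV (F n)" "inj (F n)" if "n \<ge> 1" for n
    using gcont[OF that] f continuous_on_compose[OF f(1) continuous_on_subset[OF _ subset_UNIV], of "g n"]
    unfolding F_def by (auto intro: inj_compose)
  have gS: "g n ` S0 = F n ` sphere 0 1" for n by (simp add: S0 F_def image_comp)
  have gB: "x0 \<in> F n ` ball 0 1" if "n \<ge> n0" for n
    using x0[OF that] by (simp add: F_def image_comp)
  have comp: "compact (F n ` sphere 0 1)" "F n ` sphere 0 1 \<noteq> {}" if "n \<ge> 1" for n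
    by (auto intro: compact_continuous_image continuous_on_subset[OF F(1)[OF that] subset_UNIV])
  note Hd = hausdorff_dist_singleton[OF comp]
  have upper: "dist x0 x \<le> c1 * a n" if "n \<ge> n0" "x \<in> F n ` sphere 0 1" for n x
    using Hd(1)[of n x x0] that n0 H[of n] unfolding gS by simp
  have nested: "F (Suc n) ` cball 0 1 \<subseteq> F n ` ball 0 1" if n: "n \<ge> n0" for n
  proof -
    \<comment> \<open>A farthest point of sphere n from \<open>x0\<close> lies outside the ball of
      radius \<open>c1 * a (Suc n)\<close> that contains sphere n + 1, so sphere n is the outer
      one.\<close>
    obtain s where s: "s \<in> F n ` sphere 0 1" "dist x0 s = c1 * a n"
      using Hd(2)[of n x0] n n0 H[of n] unfolding gS by auto
    have "a (Suc n) < a n" using dec n n0 by auto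
    then have "setdist (F n ` sphere 0 1) (F (Suc n) ` sphere 0 1) > 0"
      using gap[OF n] c2 unfolding gS by simp
    then have "F n ` sphere 0 1 \<inter> F (Suc n) ` sphere 0 1 = {}"
      using setdist_eq_0I by (metis disjoint_iff less_irrefl)
    then show ?thesis
      using n n0 d s F[of n] F[of "Suc n"] gB[of n] gB[of "Suc n"] upper[of "Suc n"] \<open>a (Suc n) < a n\<close> c1 pos[of "Suc n"]
      by (intro injective_image_cball_nested[where z = x0 and s = s and R = "c1 * a (Suc n)"]) auto
  qed
  have decr: "F m ` cball 0 1 \<subseteq> F n ` cball 0 1" if "n \<ge> n0" "m \<ge> n" for n m
    using that(2)
  proof (induction m rule: dec_induct)
    case (step m)
    have "F (Suc m) ` cball 0 1 \<subseteq> F m ` ball 0 1" using nested that step by simp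
    also have "\<dots> \<subseteq> F m ` cball 0 1" by (intro image_mono ball_subset_cball)
    finally show ?case using step by simp
  qed simp
  show "c2 * (a n - a (n + 1)) \<le> dist x y"
    if n: "n \<ge> n0" and m: "m > n" and x: "x \<in> g n ` S0" and y: "y \<in> g m ` S0"
  proof -
    have "F m ` cball 0 1 \<subseteq> F (Suc n) ` cball 0 1" using decr n m by simp
    moreover have "F m ` sphere 0 1 \<subseteq> F m ` cball 0 1" by (intro image_mono sphere_cball)
    ultimately have y': "y \<in> F (Suc n) ` cball 0 1" using y unfolding gS by blast
    have "F n ` ball 0 1 \<inter> F n ` sphere 0 1 = F n ` (ball 0 1 \<inter> sphere 0 1)"
      using F(2)[of n] n n0 by (simp add: image_Int)
    also have "ball 0 1 \<inter> sphere 0 1 = ({} :: (real^'n) set)" by auto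
    finally have "x \<notin> F n ` ball 0 1" using x unfolding gS by blast
    \<comment> \<open>So \<open>x\<close> is outside sphere n + 1, while \<open>y\<close> is inside
      or on it. Getting from one to the other meets that sphere, so the gap at \<open>n\<close>
      suffices however large \<open>m\<close> is.\<close>
    then have "x \<notin> F (Suc n) ` ball 0 1" using nested[OF n] by (meson ball_subset_cball image_mono subsetD)
    then show ?thesis
      using setdist_le_dist_across[of "F (Suc n)" x "g n ` S0" y] F[of "Suc n"] x y' gap[OF n]
      unfolding gS by simp
  qed
  show "dist x0 x \<le> c1 * a n" if "n \<ge> n0" "x \<in> g n ` S0"
    using upper that unfolding gS by blast
  \<comment> \<open>Both \<open>x0\<close> and a farthest point of sphere n are images under
    \<open>g n\<close> of points of this set, so their distance \<open>c1 * a n\<close> is at most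
    the ratio times its diameter. The maximum with 1 makes the bound positive.\<close>
  have "bounded (f ` cball 0 1)"
    using continuous_on_subset[OF f(1) subset_UNIV]
    by (intro compact_imp_bounded compact_continuous_image compact_cball)
  then obtain M0 where M0: "\<And>x y. \<lbrakk>x \<in> f ` cball 0 1; y \<in> f ` cball 0 1\<rbrakk> \<Longrightarrow> dist x y \<le> M0"
    unfolding bounded_two_points by blast
  show "\<exists>M>0. \<forall>n\<ge>n0. \<exists>c. (\<forall>x y. dist (g n x) (g n y) = c * dist x y) \<and> c1 * a n \<le> c * M"
  proof (rule exI[of _ "max 1 M0"], intro conjI allI impI)
    fix n assume n: "n0 \<le> n"
    obtain c where c: "c > 0" "\<And>x y. dist (g n x) (g n y) = c * dist x y"
      using similarity_dist sim n n0 by (metis le_trans)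
    obtain s where s: "s \<in> F n ` sphere 0 1" "dist x0 s = c1 * a n"
      using Hd(2)[of n x0] n n0 H[of n] unfolding gS by auto
    obtain u v where uv: "x0 = g n (f u)" "s = g n (f v)" "u \<in> cball 0 1" "v \<in> cball 0 1"
      using s(1) gB[OF n] unfolding F_def by auto
    have "c1 * a n = c * dist (f u) (f v)" using s(2) uv c by simp
    also have "\<dots> \<le> c * max 1 M0"
      using c(1) M0[of "f u" "f v"] uv by (intro mult_left_mono) auto
    finally show "\<exists>c. (\<forall>x y. dist (g n x) (g n y) = c * dist x y) \<and> c1 * a n \<le> c * max 1 M0"
      using c by blast
  qed simp
qed

text \<open>The packing bound applied to copies of \<open>P\<close> on the spheres from N to 2N - 1.
  The constants are chosen before \<open>N\<close> and \<open>P\<close>, so the estimate is uniform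
  in both.\<close>

lemma polynomially_concentric_separated_card_bound:
  fixes f :: "real^'n \<Rightarrow> real^'n" and p :: real
  assumes d: "CARD('n) \<ge> 2" and w: "concentric_witness f g c1 c2 n0 a x0 S0"
    and a: "\<And>n. n \<ge> n0 \<Longrightarrow> a n = real n powr (- p)" and p: "p > 0"
  obtains C \<kappa> where "\<kappa> > 0"
    "\<And>N P. \<lbrakk>N \<ge> n0; finite P; P \<subseteq> S0; \<And>x y. \<lbrakk>x \<in> P; y \<in> P; x \<noteq> y\<rbrakk> \<Longrightarrow> \<kappa> / real N \<le> dist x y\<rbrakk>
      \<Longrightarrow> real N * real (card P) \<le> C * real N ^ CARD('n)"
proof -
  have c1: "c1 > 0" and c2: "c2 > 0" and n0: "n0 \<ge> 1"
    using w unfolding concentric_witness_def by auto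
  have pos: "a n > 0" if "n \<ge> n0" for n using a[OF that] that n0 by simp
  note sep = concentric_separated_dist[OF d w pos]
  obtain M where M: "M > 0"
    and scale: "\<And>n. n \<ge> n0 \<Longrightarrow> \<exists>c. (\<forall>x y. dist (g n x) (g n y) = c * dist x y) \<and> c1 * a n \<le> c * M"
    using sep(3) by blast
  \<comment> \<open>Chosen so that two separations agree. With \<rho> = \<eta> N^(-p) / N, the
    number 2\<rho> is c2 times the lower bound p (2N)^(-p-1) for a difference of consecutive
    \<open>a n\<close> in the block, and also the least ratio c1 (2N)^(-p) / M times \<kappa> /
    N.\<close>
  define \<kappa> where "\<kappa> = c2 * p * M / (2 * c1)"
  define \<eta> where "\<eta> = c2 * p * 2 powr (- p - 1) / 2"
  have \<kappa>: "\<kappa> > 0" and \<eta>: "\<eta> > 0" using c1 c2 p M by (auto simp: \<kappa>_def \<eta>_def)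
  have "real N * real (card P) \<le> ((c1 + \<eta>) / \<eta>) ^ CARD('n) * real N ^ CARD('n)"
    if N: "N \<ge> n0" and P: "finite P" "P \<subseteq> S0"
      and sepP: "\<And>x y. \<lbrakk>x \<in> P; y \<in> P; x \<noteq> y\<rbrakk> \<Longrightarrow> \<kappa> / real N \<le> dist x y" for N P
  proof -
    have Npos: "real N > 0" using N n0 by simp
    define t where "t = real N powr (- p)"
    have t: "t > 0" using Npos by (simp add: t_def)
    define \<rho> where "\<rho> = \<eta> * t / real N"
    have \<rho>: "\<rho> > 0" using \<eta> t Npos by (simp add: \<rho>_def)
    have \<rho>_eq: "2 * \<rho> = c2 * p * (2 * real N) powr (- p - 1)"
      using Npos by (simp add: \<rho>_def \<eta>_def t_def powr_mult powr_diff)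
    define I where "I = {N..<2*N} \<times> P"
    \<comment> \<open>On different spheres the gap alone separates, even for equal \<open>x\<close>
      and \<open>y\<close>. The worst case is the end of the block, where n + 1 = 2N.\<close>
    have ord: "2 * \<rho> \<le> dist (g n x) (g m y)"
      if "n \<ge> N" "n < 2 * N" "m > n" "x \<in> P" "y \<in> P" for n m x y
    proof -
      have "p * (2 * real N) powr (- p - 1) \<le> p * (real n + 1) powr (- p - 1)"
        using that p Npos by (intro mult_left_mono powr_mono2') auto
      also have "\<dots> \<le> real n powr (-p) - (real n + 1) powr (-p)"
        using powr_minus_diff_ge[of "real n" "real n + 1" p] that p Npos by simp
      also have "\<dots> = a n - a (n + 1)" using a that N by (simp add: add.commute)
      finally have "2 * \<rho> \<le> c2 * (a n - a (n + 1))"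
        unfolding \<rho>_eq using c2 by (simp add: mult.assoc)
      also have "\<dots> \<le> dist (g n x) (g m y)" using that N P by (intro sep(1)[of n m]) auto
      finally show ?thesis .
    qed
    \<comment> \<open>On one sphere the separation comes from \<open>P\<close>, scaled by the ratio
      of \<open>g n\<close>, which n < 2N keeps above c1 (2N)^(-p) / M.\<close>
    have same: "2 * \<rho> \<le> dist (g n x) (g n y)"
      if n: "n \<ge> N" "n < 2 * N" and xy: "x \<in> P" "y \<in> P" "x \<noteq> y" for n x y
    proof -
      obtain c where c: "\<And>x y. dist (g n x) (g n y) = c * dist x y" "c1 * a n \<le> c * M"
        using scale[of n] n N by auto
      have an: "a n = real n powr (-p)" using a n N by simp
      have "(2 * real N) powr (-p) \<le> a n"
        unfolding an using n p Npos by (intro powr_mono2') auto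
      then have "c1 * (2 * real N) powr (-p) \<le> c * M"
        using c(2) c1 by (meson less_imp_le mult_left_mono order_trans)
      then have cc: "c1 * (2 * real N) powr (-p) / M \<le> c" using M by (simp add: pos_divide_le_eq)
      have c0: "c \<ge> 0"
        by (rule order_trans[OF _ cc]) (use c1 M in simp)
      have "2 * \<rho> = c1 * (2 * real N) powr (-p) / M * (\<kappa> / real N)"
        unfolding \<rho>_eq \<kappa>_def using M c1 Npos by (simp add: powr_diff field_simps)
      also have "\<dots> \<le> c * dist x y"
        using cc sepP[OF xy] c0 \<kappa> Npos by (intro mult_mono) auto
      finally show ?thesis by (simp add: c(1))
    qed
    have "real (card I) * \<rho> ^ DIM(real^'n) \<le> (c1 * t + \<rho>) ^ DIM(real^'n)"
    proof (rule separated_family_card_le[where x = "\<lambda>(n, q). g n q" and a = x0])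
      fix i j assume ij: "i \<in> I" "j \<in> I" "i \<noteq> j"
      obtain n q m q' where eq: "i = (n, q)" "j = (m, q')" by (cases i; cases j)
      have I: "n \<in> {N..<2*N}" "m \<in> {N..<2*N}" "q \<in> P" "q' \<in> P" "n = m \<Longrightarrow> q \<noteq> q'"
        using ij unfolding eq I_def by auto
      have "2 * \<rho> \<le> dist (g n q) (g m q')"
      proof (cases n m rule: linorder_cases)
        case less
        then show ?thesis using ord[of n m q q'] I by simp
      next
        case equal
        then show ?thesis using same[of n q q'] I by simp
      next
        case greater
        then show ?thesis using ord[of m n q' q] I by (simp add: dist_commute)
      qed
      then show "2 * \<rho> \<le> dist (case i of (n, q) \<Rightarrow> g n q) (case j of (n, q) \<Rightarrow> g n q)"
        by (simp add: eq)
    next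
      fix i assume i: "i \<in> I"
      obtain n q where nq: "i = (n, q)" "n \<ge> N" "q \<in> P" using i unfolding I_def by auto
      have "dist x0 (g n q) \<le> c1 * a n" using nq N P by (intro sep(2)) auto
      also have "a n \<le> t" unfolding t_def using a[of n] nq N p Npos by (auto intro: powr_mono2')
      finally show "dist x0 (case i of (n, q) \<Rightarrow> g n q) \<le> c1 * t" using nq c1 by simp
    qed (use P c1 t \<rho> in \<open>auto simp: I_def\<close>)
    also have "\<dots> \<le> ((c1 + \<eta>) * t) ^ DIM(real^'n)"
    proof (rule power_mono)
      \<comment> \<open>Here N \<ge> 1 is used. The radius becomes a multiple of \<open>t\<close>,
        so the powers of \<open>t\<close> cancel below.\<close>
      have "\<rho> \<le> \<eta> * t" unfolding \<rho>_def using \<eta> t N n0 by (simp add: pos_divide_le_eq)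
      then show "c1 * t + \<rho> \<le> (c1 + \<eta>) * t" by (simp add: algebra_simps)
    qed (use c1 t \<rho> in auto)
    finally have "real N * real (card P) * (\<eta> * t / real N) ^ CARD('n) \<le> ((c1 + \<eta>) * t) ^ CARD('n)"
      by (simp add: I_def \<rho>_def card_cartesian_product)
    then have "real N * real (card P) * \<eta> ^ CARD('n) * t ^ CARD('n)
        \<le> (c1 + \<eta>) ^ CARD('n) * real N ^ CARD('n) * t ^ CARD('n)"
      using Npos by (simp add: power_mult_distrib power_divide pos_divide_le_eq mult_ac)
    then have "real N * real (card P) * \<eta> ^ CARD('n) \<le> (c1 + \<eta>) ^ CARD('n) * real N ^ CARD('n)"
      by (rule mult_right_le_imp_le) (use t in simp)
    then show ?thesis
      using \<eta> by (simp add: power_divide pos_le_divide_eq)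
  qed
  with \<kappa> show thesis by (rule that)
qed

section \<open>From the box dimension to the contradiction\<close>

lemma covering_number_ge_if_lower_box_dim_gt:
  fixes E :: "(real^'n) set"
  assumes "ereal s < lower_box_dim E" "s \<ge> 0"
  shows "\<forall>\<^sub>F r in at_right 0. r powr (- s) \<le> real (covering_number r E)"
proof -
  have "\<forall>\<^sub>F r in at_right 0. ereal s < ereal (ln (real (covering_number r E)) / - ln r)"
    using assms(1) unfolding lower_box_dim_def by (rule less_LiminfD)
  moreover have "\<forall>\<^sub>F r::real in at_right 0. r \<in> {0<..<1}"
    by (rule eventually_at_right_real) simp
  ultimately show ?thesis
  proof eventually_elim
    case (elim r)
    then have r: "0 < r" "r < 1" and less: "s < ln (real (covering_number r E)) / - ln r" by auto
    have "ln r < 0" using r by simp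
    then have 1: "- s * ln r < ln (real (covering_number r E))"
      using less by (simp add: field_simps)
    \<comment> \<open>With s \<ge> 0 the logarithm of the covering number is positive; as
      \<open>ln 0\<close> is 0 by convention, this excludes the covering number 0.\<close>
    moreover have "0 \<le> - s * ln r" using \<open>ln r < 0\<close> assms(2) by (simp add: mult_nonneg_nonpos)
    ultimately have "covering_number r E \<noteq> 0" by (auto intro: Nat.gr0I)
    then show ?case
      using 1 r by (simp add: powr_def flip: ln_ge_iff)
  qed
qed

theorem theorem1p2:
  fixes S0 :: "(real^'n) set" and p :: real
  assumes "CARD('n) \<ge> 2"
    and "topological_sphere S0"
    and "lower_box_dim S0 \<in> {ereal (real CARD('n) - 1) <.. ereal (real CARD('n))}"
    and "p > 0"
  shows "\<not> (\<exists>S x0. p_concentric_sphere_collection p S x0 S0)"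
proof
  assume "\<exists>S x0. p_concentric_sphere_collection p S x0 S0"
  then obtain x0 f g c1 c2 n0 a where w: "concentric_witness f g c1 c2 n0 a x0 S0"
    and a: "\<And>n. n \<ge> n0 \<Longrightarrow> a n = real n powr (- p)"
    unfolding p_concentric_sphere_collection_def by blast
  let ?d = "CARD('n)"
  obtain C \<kappa> where \<kappa>: "\<kappa> > 0" and bound:
    "\<And>N P. \<lbrakk>N \<ge> n0; finite P; P \<subseteq> S0; \<And>x y. \<lbrakk>x \<in> P; y \<in> P; x \<noteq> y\<rbrakk> \<Longrightarrow> \<kappa> / real N \<le> dist x y\<rbrakk>
      \<Longrightarrow> real N * real (card P) \<le> C * real N ^ ?d"
    using polynomially_concentric_separated_card_bound[OF assms(1) w a assms(4)] by metis
  obtain h where "homeomorphism UNIV UNIV f h" "S0 = f ` sphere 0 1"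
    using w unfolding concentric_witness_def self_homeomorphism_def by blast
  then have "bounded S0"
    unfolding homeomorphism_def
    by (meson compact_continuous_image compact_imp_bounded compact_sphere continuous_on_subset subset_UNIV)
  \<comment> \<open>The upper inequality gives at least (N/k)^s mesh cubes at scale k/N; the lower
    one leaves a positive power of N at the end.\<close>
  obtain s where s: "real ?d - 1 < s" "ereal s < lower_box_dim S0"
    using assms(3) ereal_dense2 by (metis ereal_less(1) greaterThanAtMost_iff less_ereal.simps(1))
  have "s \<ge> 0" using s(1) assms(1) by linarith
  define A where "A = (4 * real ?d) ^ ?d * measure lborel (ball (0::real^'n) 1)"
  have "A \<ge> 0" by (simp add: A_def)
  \<comment> \<open>At mesh size k/N, the separation 2dr of the packing estimate is exactly
    \<kappa>/N.\<close>
  define k where "k = \<kappa> / (2 * real ?d)"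
  have k: "k > 0" using \<kappa> by (simp add: k_def)
  have "filterlim (\<lambda>N. k / real N) (at_right 0) sequentially"
    using k by real_asymp
  then have "\<forall>\<^sub>F N in sequentially. (k / real N) powr (- s) \<le> real (covering_number (k / real N) S0)"
    using covering_number_ge_if_lower_box_dim_gt[OF s(2) \<open>s \<ge> 0\<close>] unfolding filterlim_iff by blast
  moreover have "\<forall>\<^sub>F N in sequentially. N \<ge> max 1 n0" by (rule eventually_ge_at_top)
  ultimately have "\<forall>\<^sub>F N in sequentially. real N powr (s - (real ?d - 1)) \<le> C * A * k powr s"
  proof eventually_elim
    case (elim N)
    then have N: "real N > 0" "N \<ge> n0" by auto
    have r: "k / real N > 0" using k N by simp
    obtain P where P: "finite P" "P \<subseteq> S0"
      "\<And>x y. \<lbrakk>x \<in> P; y \<in> P; x \<noteq> y\<rbrakk> \<Longrightarrow> 2 * real ?d * (k / real N) \<le> dist x y"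
      "real (covering_number (k / real N) S0) \<le> real (card P) * A"
      using covering_number_le_separated_card[OF \<open>bounded S0\<close> r] unfolding A_def by metis
    have "2 * real ?d * (k / real N) = \<kappa> / real N" by (simp add: k_def)
    from P(3)[unfolded this] have "real N * real (card P) \<le> C * real N ^ ?d"
      by (rule bound[OF N(2) P(1,2)])
    then have "real N * real (card P) * A \<le> C * real N ^ ?d * A"
      using \<open>A \<ge> 0\<close> by (rule mult_right_mono)
    moreover have "real N * (k / real N) powr (- s) \<le> real N * (real (card P) * A)"
      using elim(1) P(4) N by (intro mult_left_mono) auto
    \<comment> \<open>The left side is of order N^(1+s) and the right side of order N^d; their
      quotient is the power of N with exponent s - (d - 1).\<close>
    ultimately have "real N * (k / real N) powr (- s) \<le> C * real N ^ ?d * A" by (simp add: mult.assoc)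
    moreover have "(k / real N) powr (- s) = real N powr s / k powr s"
      using k N by (simp add: powr_divide powr_minus field_simps)
    moreover have "real N powr (s - (real ?d - 1)) = real N * real N powr s / real N ^ ?d"
      using N by (simp add: powr_diff powr_realpow)
    ultimately have "real N powr (s - (real ?d - 1)) * real N ^ ?d \<le> C * A * k powr s * real N ^ ?d"
      using k N by (simp add: field_simps)
    then show ?case using N by (simp add: mult_le_cancel_right)
  qed
  moreover have "filterlim (\<lambda>N. real N powr (s - (real ?d - 1))) at_top sequentially"
    using s(1) by real_asymp
  then have "\<forall>\<^sub>F N in sequentially. C * A * k powr s < real N powr (s - (real ?d - 1))"
    by (simp add: filterlim_at_top_dense)
  ultimately have "\<forall>\<^sub>F N in sequentially. False"
    by eventually_elim simp
  then show False by simp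
qed

end
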